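(* Let $\psi_1,\dots,\psi_K$ be the CARE basis functions, let $m_i=(1,\psi_i)_Q$, $\boldsymbol m=(m_1,\dots,m_K)^{T}$, and let $(\boldsymbol c^n,\boldsymbol d^{n+1/2},r^n)$ be a solution of the fully discrete CARE-SAV scheme $$\frac{\boldsymbol c^{n+1}-\boldsymbol c^n}{\Delta t}=\boldsymbol G_K\boldsymbol d^{n+1/2},\quad \boldsymbol d^{n+1/2}=\boldsymbol L_K\frac{\boldsymbol c^{n+1}+\boldsymbol c^n}{2}+\frac{r^{n+1}+r^n}{2}\boldsymbol b^{n+1/2},\quad \frac{r^{n+1}-r^n}{\Delta t}=\frac12(\boldsymbol b^{n+1/2})^{T}\frac{\boldsymbol c^{n+1}-\boldsymbol c^n}{\Delta t},\qquad n\ge0.$$ Set $\mathcal M_Q^n=\boldsymbol m^{T}\boldsymbol c^n$. If $\boldsymbol m^{T}\boldsymbol G_K=0$, then for every time step $n\ge0$ $$\mathcal M_Q^{n+1}=\mathcal M_Q^n .$$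
   Context: $(u,v)_Q=\sum_{q=1}^Nw_qu(\boldsymbol x_q)v(\boldsymbol x_q)$ is the quadrature inner product with nodes $\boldsymbol x_q$ and weights $w_q$; $1$ is the constant function; $\psi_1,\dots,\psi_K$ are functions satisfying $(\psi_i,\psi_j)_Q=\delta_{ij}$. $\boldsymbol G_K,\boldsymbol L_K\in\mathbb R^{K\times K}$ are the reduced mobility and linear-energy matrices, $\Delta t>0$, $\boldsymbol c^n,\boldsymbol d^{n+1/2}\in\mathbb R^K$, $r^n\in\mathbb R$, and $\boldsymbol b^{n+1/2}=\boldsymbol b_K(\overline{\boldsymbol c}^{\,n+1/2})\in\mathbb R^K$ with $\boldsymbol b_K$ a map from $\mathbb R^K$ to $\mathbb R^K$ (the projected SAV nonlinearity), $\overline{\boldsymbol c}^{\,n+1/2}=(3\boldsymbol c^n-\boldsymbol c^{n-1})/2$ for $n\ge1$ and $\overline{\boldsymbol c}^{\,1/2}=\boldsymbol c^0$. $\mathcal M_Q^n$ is the discrete mass of $\phi_K^n=\sum_ic_i^n\psi_i$. *)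

theory Defs
  imports "HOL-Analysis.Analysis"
begin

definition quad_inner ::
    "nat \<Rightarrow> (nat \<Rightarrow> real) \<Rightarrow> (nat \<Rightarrow> 'a) \<Rightarrow> ('a \<Rightarrow> real) \<Rightarrow> ('a \<Rightarrow> real) \<Rightarrow> real" where
  "quad_inner N w x u v = (\<Sum>q = 1..N. w q * u (x q) * v (x q))"

definition quad_orthonormal ::
    "nat \<Rightarrow> (nat \<Rightarrow> real) \<Rightarrow> (nat \<Rightarrow> 'a) \<Rightarrow> ('k::finite \<Rightarrow> 'a \<Rightarrow> real) \<Rightarrow> bool" where
  "quad_orthonormal N w x \<psi> \<longleftrightarrow>
     (\<forall>i j. quad_inner N w x (\<psi> i) (\<psi> j) = (if i = j then 1 else 0))"

definition reconstruction :: "('k::finite \<Rightarrow> 'a \<Rightarrow> real) \<Rightarrow> real ^ 'k \<Rightarrow> 'a \<Rightarrow> real" where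
  "reconstruction \<psi> c = (\<lambda>y. \<Sum>i\<in>UNIV. c $ i * \<psi> i y)"

definition mass_vector ::
    "nat \<Rightarrow> (nat \<Rightarrow> real) \<Rightarrow> (nat \<Rightarrow> 'a) \<Rightarrow> ('k::finite \<Rightarrow> 'a \<Rightarrow> real) \<Rightarrow> real ^ 'k" where
  "mass_vector N w x \<psi> = (\<chi> i. quad_inner N w x (\<lambda>_. 1) (\<psi> i))"

definition discrete_mass ::
    "nat \<Rightarrow> (nat \<Rightarrow> real) \<Rightarrow> (nat \<Rightarrow> 'a) \<Rightarrow> ('k::finite \<Rightarrow> 'a \<Rightarrow> real) \<Rightarrow> real ^ 'k \<Rightarrow> real" where
  "discrete_mass N w x \<psi> c = mass_vector N w x \<psi> \<bullet> c"

lemma discrete_mass_eq_quad_inner: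
  "discrete_mass N w x \<psi> c = quad_inner N w x (\<lambda>_. 1) (reconstruction \<psi> c)"
proof -
  have "discrete_mass N w x \<psi> c = (\<Sum>i\<in>UNIV. \<Sum>q = 1..N. w q * (c $ i * \<psi> i (x q)))"
    by (simp add: discrete_mass_def mass_vector_def quad_inner_def inner_vec_def
        sum_distrib_left sum_distrib_right mult_ac)
  also have "\<dots> = (\<Sum>q = 1..N. \<Sum>i\<in>UNIV. w q * (c $ i * \<psi> i (x q)))"
    by (rule sum.swap)
  also have "\<dots> = quad_inner N w x (\<lambda>_. 1) (reconstruction \<psi> c)"
    by (simp add: quad_inner_def reconstruction_def sum_distrib_left)
  finally show ?thesis .
qed

text \<open>Half-step quantities are indexed by the integer part of their time index:
  \<open>extrapolate c n\<close> is the extrapolation of \<open>c\<close> to time level \<open>n + 1/2\<close>, and below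
  \<open>d n\<close> stands for the value of \<open>d\<close> at level \<open>n + 1/2\<close>.\<close>

definition extrapolate :: "(nat \<Rightarrow> real ^ 'k::finite) \<Rightarrow> nat \<Rightarrow> real ^ 'k" where
  "extrapolate c n = (if n = 0 then c 0 else (3 *\<^sub>R c n - c (n - 1)) /\<^sub>R 2)"

definition care_sav_solution ::
    "real ^ 'k ^ 'k \<Rightarrow> real ^ 'k ^ 'k \<Rightarrow> (real ^ 'k \<Rightarrow> real ^ 'k) \<Rightarrow> real \<Rightarrow>
     (nat \<Rightarrow> real ^ 'k::finite) \<Rightarrow> (nat \<Rightarrow> real ^ 'k) \<Rightarrow> (nat \<Rightarrow> real) \<Rightarrow> bool" where
  "care_sav_solution G L b \<Delta>t c d r \<longleftrightarrow>
     (\<forall>n. (c (n + 1) - c n) /\<^sub>R \<Delta>t = G *v d n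
        \<and> d n = L *v ((c (n + 1) + c n) /\<^sub>R 2) + ((r (n + 1) + r n) / 2) *\<^sub>R b (extrapolate c n)
        \<and> (r (n + 1) - r n) / \<Delta>t
            = 1 / 2 * (b (extrapolate c n) \<bullet> ((c (n + 1) - c n) /\<^sub>R \<Delta>t)))"

end

theory Submission
  imports Defs
begin

text \<open>Mass is linear in the coefficient vector, so its increment over one step is the pairing of
  the mass vector \<open>m\<close> with the update \<open>\<Delta>t *\<^sub>R (G *v d n)\<close>. Moving \<open>G\<close> onto the other
  factor turns this pairing into \<open>\<Delta>t * ((m v* G) \<bullet> d n)\<close>, and \<open>m v* G\<close> is zero.\<close>

theorem corollary5p1:
  fixes N :: nat and w :: "nat \<Rightarrow> real" and x :: "nat \<Rightarrow> 'a"
    and \<psi> :: "'k::finite \<Rightarrow> 'a \<Rightarrow> real"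
    and G L :: "real ^ 'k ^ 'k" and b :: "real ^ 'k \<Rightarrow> real ^ 'k" and \<Delta>t :: real
    and c d :: "nat \<Rightarrow> real ^ 'k" and r :: "nat \<Rightarrow> real"
  assumes "quad_orthonormal N w x \<psi>"
    and "\<Delta>t > 0"
    and "care_sav_solution G L b \<Delta>t c d r"
    and "mass_vector N w x \<psi> v* G = 0"
  shows "\<forall>n. discrete_mass N w x \<psi> (c (n + 1)) = discrete_mass N w x \<psi> (c n)"
proof
  fix n
  let ?m = "mass_vector N w x \<psi>"
  have "(c (n + 1) - c n) /\<^sub>R \<Delta>t = G *v d n"
    using assms(3) by (simp add: care_sav_solution_def)
  then have step: "c (n + 1) - c n = \<Delta>t *\<^sub>R (G *v d n)"
    using assms(2) by (metis less_irrefl scaleR_scaleR right_inverse scaleR_one)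
  have "?m \<bullet> (c (n + 1) - c n) = \<Delta>t * ((?m v* G) \<bullet> d n)"
    by (simp only: step inner_scaleR_right dot_lmul_matrix)
  also have "\<dots> = 0"
    using assms(4) by simp
  finally show "discrete_mass N w x \<psi> (c (n + 1)) = discrete_mass N w x \<psi> (c n)"
    by (simp add: discrete_mass_def inner_diff_right)
qed

end
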